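(* Let $\mathbb{F}_q$ be a finite field with $q$ elements and let $L$ be the Heisenberg Lie algebra over $\mathbb{F}_q$, i.e. the three-dimensional Lie algebra with basis $\{e,f,h\}$ and brackets $[e,f]=h$, $[e,h]=[f,h]=0$. Then the number of triangles in the comaximal graph $\Gamma(L)$ is $$\mathfrak{t}(\Gamma(L)) = \frac{q(q-1)(q+1)^4}{6}.$$
   Context: For a finite-dimensional Lie algebra $L$, the comaximal graph $\Gamma(L)$ is the simple undirected graph whose vertices are the proper nonzero Lie subalgebras of $L$; two distinct vertices $A,B$ are adjacent if and only if the Lie subalgebra $\langle A,B\rangle$ generated by $A\cup B$ equals $L$. A triangle of a graph is a set of three pairwise adjacent vertices, and $\mathfrak{t}(\Gamma)$ denotes the number of triangles of $\Gamma$. *)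

theory Defs
  imports Complex_Main "HOL-Library.Cardinality"
begin

locale lie_algebra = vector_space scale
  for scale :: "'a::field \<Rightarrow> 'b::ab_group_add \<Rightarrow> 'b" +
  fixes bracket :: "'b \<Rightarrow> 'b \<Rightarrow> 'b"
  assumes bracket_add_left: "bracket (x + y) z = bracket x z + bracket y z"
    and bracket_add_right: "bracket x (y + z) = bracket x y + bracket x z"
    and bracket_scale_left: "bracket (scale c x) y = scale c (bracket x y)"
    and bracket_scale_right: "bracket x (scale c y) = scale c (bracket x y)"
    and bracket_self: "bracket x x = 0"
    and jacobi: "bracket x (bracket y z) + bracket y (bracket z x) + bracket z (bracket x y) = 0"

text \<open>A simple undirected graph is a pair \<open>(V, E)\<close> of a vertex set and a set of
  two-element subsets of \<open>V\<close>.\<close>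

type_synonym 'v graph = "'v set \<times> 'v set set"

definition triangles :: "'v graph \<Rightarrow> 'v set set" where
  "triangles G = {T. T \<subseteq> fst G \<and> card T = 3 \<and> (\<forall>A\<in>T. \<forall>B\<in>T. A \<noteq> B \<longrightarrow> {A, B} \<in> snd G)}"

definition num_triangles :: "'v graph \<Rightarrow> nat" where
  "num_triangles G = card (triangles G)"

context lie_algebra
begin

definition subalgebra :: "'b set \<Rightarrow> bool" where
  "subalgebra S \<longleftrightarrow> subspace S \<and> (\<forall>x\<in>S. \<forall>y\<in>S. bracket x y \<in> S)"

definition generated_subalgebra :: "'b set \<Rightarrow> 'b set" where
  "generated_subalgebra X = subalgebra hull X"

definition comaximal_vertices :: "'b set set" where
  "comaximal_vertices = {A. subalgebra A \<and> A \<noteq> {0} \<and> A \<noteq> UNIV}"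

definition comaximal_graph :: "'b set graph" where
  "comaximal_graph =
    (comaximal_vertices,
     {{A, B} | A B. A \<in> comaximal_vertices \<and> B \<in> comaximal_vertices \<and> A \<noteq> B \<and>
        generated_subalgebra (A \<union> B) = UNIV})"

end

text \<open>The brackets \<open>[f, e]\<close>, \<open>[h, e]\<close>, \<open>[h, f]\<close> follow from \<open>bracket_self\<close> and
  bilinearity.\<close>

locale heisenberg_lie_algebra = lie_algebra scale bracket
  for scale :: "'a::field \<Rightarrow> 'b::ab_group_add \<Rightarrow> 'b"
    and bracket :: "'b \<Rightarrow> 'b \<Rightarrow> 'b" +
  fixes e f h :: 'b
  assumes basis_distinct: "distinct [e, f, h]"
    and basis_independent: "independent {e, f, h}"
    and basis_span: "span {e, f, h} = UNIV"
    and bracket_e_f: "bracket e f = h"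
    and bracket_e_h: "bracket e h = 0"
    and bracket_f_h: "bracket f h = 0"

end

theory Submission
  imports Defs "HOL-Library.FuncSet"
begin

text \<open>Modulo the centre \<open>Z\<close>, spanned by \<open>h\<close>, the Heisenberg algebra is an abelian plane, and two
  subalgebras generate everything iff their images in that plane span it. A vertex other than
  \<open>Z\<close> has a line of the plane as its image, and each of the \<open>q + 1\<close> lines is the image of
  \<open>q + 1\<close> vertices: its full preimage and the \<open>q\<close> one-dimensional complements of \<open>Z\<close> in it.
  So the comaximal graph is the complete \<open>(q + 1)\<close>-partite graph with parts of size \<open>q + 1\<close>,
  together with the isolated vertex \<open>Z\<close>, and it has \<open>binomial(q + 1, 3) (q + 1)\<^sup>3\<close> triangles.\<close>

section \<open>Edge membership, and counting transversal subsets of a product\<close>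

lemma doubleton_mem_comaximal_edges:
  assumes "lie_algebra scale bracket"
  shows "{A, B} \<in> snd (lie_algebra.comaximal_graph scale bracket) \<longleftrightarrow>
    A \<in> lie_algebra.comaximal_vertices scale bracket \<and>
    B \<in> lie_algebra.comaximal_vertices scale bracket \<and> A \<noteq> B \<and>
    lie_algebra.generated_subalgebra scale bracket (A \<union> B) = UNIV"
proof -
  interpret lie_algebra scale bracket by fact
  show ?thesis
    unfolding comaximal_graph_def by (auto simp: doubleton_eq_iff Un_commute)
qed

text \<open>Such a \<open>T\<close> is the graph of a function into \<open>B\<close> whose domain is
  a \<open>k\<close>-subset of \<open>A\<close>: choose the domain, then the function.\<close>

lemma card_subsets_inj_on_fst:
  assumes "finite A" "finite B"
  shows "card {T. T \<subseteq> A \<times> B \<and> card T = k \<and> inj_on fst T} = (card A choose k) * card B ^ k"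
    (is "card ?R = _")
proof (cases "k = 0")
  case True
  have "T = {}" if "T \<subseteq> A \<times> B" "card T = 0" for T
    using that assms by (metis card_0_eq finite_SigmaI finite_subset)
  then have "?R = {{}}" using True by auto
  then show ?thesis using True by simp
next
  case False
  define D where "D = Sigma {S. S \<subseteq> A \<and> card S = k} (\<lambda>S. S \<rightarrow>\<^sub>E B)"
  define g where "g = (\<lambda>(S :: 'a set, \<phi> :: 'a \<Rightarrow> 'b). (\<lambda>x. (x, \<phi> x)) ` S)"
  have fin: "finite S" if "card S = k" for S :: "'a set"
    using that False card.infinite by fastforce
  have "bij_betw g D ?R"
  proof (rule bij_betw_imageI)
    show "inj_on g D"
    proof (rule inj_onI)
      fix p p' assume "p \<in> D" "p' \<in> D" "g p = g p'"
      obtain S \<phi> S' \<psi> where p: "p = (S, \<phi>)" "p' = (S', \<psi>)" by (metis surj_pair)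
      have eq: "(\<lambda>x. (x, \<phi> x)) ` S = (\<lambda>x. (x, \<psi> x)) ` S'"
        using \<open>g p = g p'\<close> by (simp add: g_def p)
      have "S = S'" using arg_cong[OF eq, of "image fst"] by (simp add: image_image)
      moreover have "\<phi> x = \<psi> x" if "x \<in> S" for x using eq that by auto
      ultimately have "\<phi> = \<psi>"
        using \<open>p \<in> D\<close> \<open>p' \<in> D\<close> by (auto simp: D_def p intro: PiE_ext)
      with \<open>S = S'\<close> show "p = p'" by (simp add: p)
    qed
    show "g ` D = ?R"
    proof (intro equalityI subsetI)
      fix T assume "T \<in> g ` D"
      then obtain S \<phi> where S: "S \<subseteq> A" "card S = k" "\<phi> \<in> S \<rightarrow>\<^sub>E B"
        and T: "T = (\<lambda>x. (x, \<phi> x)) ` S"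
        by (auto simp: D_def g_def)
      have "card T = k" unfolding T by (subst card_image) (auto simp: inj_on_def S)
      then show "T \<in> ?R" using S by (auto simp: T inj_on_def)
    next
      fix T assume "T \<in> ?R"
      then have T: "T \<subseteq> A \<times> B" "card T = k" "inj_on fst T" by auto
      \<comment> \<open>\<open>T\<close> read as a function on its projection;
        \<open>restrict\<close> gives the extensional representative that makes the encoding by
        \<open>D\<close> unique.\<close>
      define \<phi> where "\<phi> = restrict (\<lambda>x. snd (inv_into T fst x)) (fst ` T)"
      have \<phi>: "\<phi> (fst z) = snd z" if "z \<in> T" for z
        using that T(3) by (simp add: \<phi>_def)
      have "\<phi> \<in> fst ` T \<rightarrow>\<^sub>E B"
      proof (rule PiE_I)
        fix x assume "x \<in> fst ` T"
        then obtain z where "z \<in> T" "x = fst z" by blast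
        then show "\<phi> x \<in> B" using T(1) \<phi> by auto
      qed (simp add: \<phi>_def)
      then have "(fst ` T, \<phi>) \<in> D"
        using T by (auto simp: D_def card_image)
      moreover have "(\<lambda>z. (fst z, \<phi> (fst z))) ` T = (\<lambda>z. z) ` T"
        by (intro image_cong) (simp_all add: \<phi>)
      then have "g (fst ` T, \<phi>) = T"
        by (simp add: g_def image_image)
      ultimately show "T \<in> g ` D" by (metis image_eqI)
    qed
  qed
  then have "card ?R = card D" by (simp add: bij_betw_same_card)
  also have "\<dots> = (\<Sum>S\<in>{S. S \<subseteq> A \<and> card S = k}. card (S \<rightarrow>\<^sub>E B))"
    unfolding D_def using assms by (intro card_SigmaI) (auto intro: finite_PiE fin)
  also have "\<dots> = (\<Sum>S\<in>{S. S \<subseteq> A \<and> card S = k}. card B ^ k)"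
    by (intro sum.cong) (auto simp: card_PiE fin)
  also have "\<dots> = (card A choose k) * card B ^ k"
    using assms by (simp add: n_subsets)
  finally show ?thesis .
qed

text \<open>The lines of a plane over \<open>'a\<close> are indexed by \<open>'a option\<close>, where \<open>None\<close> is the point at
  infinity; \<open>(dir_fst d, dir_snd d)\<close> spans the line \<open>d\<close>.\<close>

definition dir_fst :: "'a::field option \<Rightarrow> 'a" where
  "dir_fst d = (case d of None \<Rightarrow> 0 | Some t \<Rightarrow> 1)"

definition dir_snd :: "'a::field option \<Rightarrow> 'a" where
  "dir_snd d = (case d of None \<Rightarrow> 1 | Some t \<Rightarrow> t)"

lemma dir_det_eq_0_iff: "dir_fst d * dir_snd d' - dir_snd d * dir_fst d' = 0 \<longleftrightarrow> d = d'"
  by (auto simp: dir_fst_def dir_snd_def split: option.splits)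

lemma dir_nonzero: "dir_fst d \<noteq> 0 \<or> dir_snd d \<noteq> 0"
  by (auto simp: dir_fst_def dir_snd_def split: option.splits)

lemma dir_exhaust:
  obtains d r where "a = r * dir_fst d" "b = r * dir_snd d"
proof (cases "a = 0")
  case True
  then show ?thesis using that[of b None] by (simp add: dir_fst_def dir_snd_def)
next
  case False
  then show ?thesis using that[of a "Some (b / a)"] by (simp add: dir_fst_def dir_snd_def)
qed

lemma dir_proportional:
  assumes "dir_fst d * b - dir_snd d * a = 0"
  obtains r where "a = r * dir_fst d" "b = r * dir_snd d"
  \<comment> \<open>The multiplier is \<open>b\<close> for direction (0, 1) and \<open>a\<close> for
    direction (1, t).\<close>
  using assms that[of b] that[of a]
  by (cases d) (auto simp: dir_fst_def dir_snd_def mult.commute)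

section \<open>Coordinates and the determinant formula for the bracket\<close>

context heisenberg_lie_algebra
begin

definition vec :: "'a \<Rightarrow> 'a \<Rightarrow> 'a \<Rightarrow> 'b" where
  "vec a b c = scale a e + scale b f + scale c h"

lemma vec_add: "vec a b c + vec a' b' c' = vec (a + a') (b + b') (c + c')"
  by (simp add: vec_def scale_left_distrib algebra_simps)

lemma vec_scale: "scale r (vec a b c) = vec (r * a) (r * b) (r * c)"
  by (simp add: vec_def scale_right_distrib)

lemma vec_zero: "vec 0 0 0 = 0"
  by (simp add: vec_def)

lemma vec_eq_0D:
  assumes "vec a b c = 0"
  shows "a = 0" "b = 0" "c = 0"
proof -
  \<comment> \<open>Independence speaks of weights on vectors, so the coordinates are attached to
    the basis vectors, unambiguously because these are distinct.\<close>
  define w where "w = (\<lambda>v. if v = e then a else if v = f then b else c)"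
  have "(\<Sum>v\<in>{e, f, h}. scale (w v) v) = 0"
    using assms basis_distinct by (auto simp: w_def vec_def add.assoc)
  then have "w v = 0" if "v \<in> {e, f, h}" for v
    using independentD[OF basis_independent _ subset_refl] that by blast
  from this[of e] this[of f] this[of h] show "a = 0" "b = 0" "c = 0"
    using basis_distinct by (auto simp: w_def)
qed

lemma vec_eq_iff: "vec a b c = vec a' b' c' \<longleftrightarrow> a = a' \<and> b = b' \<and> c = c'"
proof
  assume eq: "vec a b c = vec a' b' c'"
  have "vec (a - a') (b - b') (c - c') = vec a b c + scale (- 1) (vec a' b' c')"
    by (simp add: vec_scale vec_add)
  also have "\<dots> = 0" by (simp add: eq)
  finally show "a = a' \<and> b = b' \<and> c = c'" using vec_eq_0D by fastforce
qed simp

lemma vec_exhaust: obtains a b c where "x = vec a b c"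
proof -
  have "x \<in> span {e, f, h}" using basis_span by simp
  then obtain a b c where "x - scale a e - scale b f - scale c h = 0"
    by (auto simp: span_breakdown_eq)
  then show ?thesis using that[of a b c] by (simp add: vec_def algebra_simps)
qed

lemma bracket_vec: "bracket (vec a b c) (vec a' b' c') = vec 0 0 (a * b' - b * a')"
proof -
  have flip: "bracket x y = - bracket y x" for x y
  proof -
    have "bracket (x + y) (x + y) = bracket x y + bracket y x"
      unfolding bracket_add_left bracket_add_right by (simp add: bracket_self)
    then show ?thesis by (simp add: bracket_self eq_neg_iff_add_eq_0)
  qed
  have "bracket f e = - h" "bracket h e = 0" "bracket h f = 0"
    by (simp_all add: flip[of f e] flip[of h e] flip[of h f] bracket_e_f bracket_e_h bracket_f_h)
  then show ?thesis
    by (simp add: vec_def bracket_add_left bracket_add_right bracket_scale_left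
        bracket_scale_right bracket_self bracket_e_f bracket_e_h bracket_f_h scale_left_diff_distrib
        mult.commute)
qed

text \<open>The determinant is the \<open>h\<close>-coefficient of the bracket of the two elements.
  If it is nonzero, \<open>A\<close> contains the centre, and the two elements span the
  quotient.\<close>

lemma subalgebra_eq_UNIV:
  assumes A: "subalgebra A" and x: "vec a b c \<in> A" and y: "vec a' b' c' \<in> A"
    and det: "a * b' - b * a' \<noteq> 0"
  shows "A = UNIV"
proof -
  have sub: "subspace A" and br: "\<And>x y. x \<in> A \<Longrightarrow> y \<in> A \<Longrightarrow> bracket x y \<in> A"
    using A by (auto simp: subalgebra_def)
  define D where "D = a * b' - b * a'"
  have z: "vec 0 0 D \<in> A" using br[OF x y] by (simp add: bracket_vec D_def)
  have "vec u v w \<in> A" for u v w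
  proof -
    \<comment> \<open>Cramer's rule in the quotient plane; the multiple of \<open>vec 0 0 D\<close>
      then corrects the \<open>h\<close>-coordinate.\<close>
    define r where "r = (u * b' - v * a') / D"
    define s where "s = (a * v - b * u) / D"
    have "vec u v w = scale r (vec a b c) + scale s (vec a' b' c')
        + scale ((w - r * c - s * c') / D) (vec 0 0 D)"
      using det unfolding vec_scale vec_add vec_eq_iff r_def s_def D_def[symmetric]
      by (simp add: field_simps) (simp add: D_def algebra_simps)
    then show ?thesis
      using sub x y z by (simp add: subspace_add subspace_scale)
  qed
  then show ?thesis by (metis UNIV_eq_I vec_exhaust)
qed

section \<open>Parametrization of the vertices\<close>

definition center :: "'b set" where
  "center = range (vec 0 0)"

definition plane :: "'a option \<Rightarrow> 'b set" where
  "plane d = {vec (r * dir_fst d) (r * dir_snd d) c |r c. True}"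

definition line :: "'a option \<Rightarrow> 'a \<Rightarrow> 'b set" where
  "line d s = {vec (r * dir_fst d) (r * dir_snd d) (r * s) |r. True}"

text \<open>The first component names the part, the second its member: \<open>None\<close> is the
  full preimage, \<open>Some s\<close> the complement of the centre at height \<open>s\<close> over
  the direction vector.\<close>

definition vertex :: "'a option \<times> 'a option \<Rightarrow> 'b set" where
  "vertex p = (case snd p of None \<Rightarrow> plane (fst p) | Some s \<Rightarrow> line (fst p) s)"

text \<open>Elements of a plane have proportional images modulo the centre, so all their brackets
  vanish.\<close>

lemma subalgebra_plane: "subalgebra (plane d)"
  unfolding subalgebra_def
proof (intro conjI subspaceI ballI)
  show "0 \<in> plane d"
    unfolding plane_def using vec_zero by (metis (mono_tags, lifting) mem_Collect_eq mult_zero_left)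
next
  fix x y assume "x \<in> plane d" "y \<in> plane d"
  then show "x + y \<in> plane d" "bracket x y \<in> plane d"
    by (auto simp: plane_def vec_add bracket_vec vec_eq_iff simp flip: distrib_right)
next
  fix c x assume "x \<in> plane d"
  then show "scale c x \<in> plane d"
    by (auto simp: plane_def vec_scale vec_eq_iff simp flip: mult.assoc)
qed

lemma subalgebra_line: "subalgebra (line d s)"
  unfolding subalgebra_def
proof (intro conjI subspaceI ballI)
  show "0 \<in> line d s"
    unfolding line_def using vec_zero by (metis (mono_tags, lifting) mem_Collect_eq mult_zero_left)
next
  fix x y assume "x \<in> line d s" "y \<in> line d s"
  then show "x + y \<in> line d s" "bracket x y \<in> line d s"
    by (auto simp: line_def vec_add bracket_vec vec_eq_iff simp flip: distrib_right)
next
  fix c x assume "x \<in> line d s"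
  then show "scale c x \<in> line d s"
    by (auto simp: line_def vec_scale vec_eq_iff simp flip: mult.assoc)
qed

lemma plane_neq_UNIV: "plane d \<noteq> UNIV"
proof
  assume "plane d = UNIV"
  then have "vec (- dir_snd d) (dir_fst d) 0 \<in> plane d" "vec 1 0 0 \<in> plane d" "vec 0 1 0 \<in> plane d"
    by auto
  then show False
    \<comment> \<open>\<open>plane None\<close> misses \<open>vec 1 0 0\<close>, and
      \<open>plane (Some t)\<close> misses \<open>vec 0 1 0\<close>.\<close>
    by (cases d) (auto simp: plane_def vec_eq_iff dir_fst_def dir_snd_def)
qed

lemma center_subset_plane: "center \<subseteq> plane d"
  by (auto simp: center_def plane_def vec_eq_iff intro: exI[of _ 0])

lemma vertex_subset_plane: "vertex (d, m) \<subseteq> plane d"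
  by (auto simp: vertex_def line_def plane_def split: option.splits)

lemma vertex_contains_dir: obtains c where "vec (dir_fst d) (dir_snd d) c \<in> vertex (d, m)"
proof (cases m)
  case None
  then show ?thesis using that[of 0] by (force simp: vertex_def plane_def vec_eq_iff intro: exI[of _ 1])
next
  case (Some s)
  then show ?thesis using that[of s] by (force simp: vertex_def line_def vec_eq_iff intro: exI[of _ 1])
qed

lemma subalgebra_vertex: "subalgebra (vertex p)"
  by (auto simp: vertex_def subalgebra_plane subalgebra_line split: option.splits)

lemma vertex_in_comaximal_vertices: "vertex p \<in> comaximal_vertices"
proof -
  obtain d m where p: "p = (d, m)" by (cases p)
  obtain c where "vec (dir_fst d) (dir_snd d) c \<in> vertex p"
    using vertex_contains_dir p by blast
  then have "vertex p \<noteq> {0}"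
    using vec_eq_0D dir_nonzero by blast
  moreover have "vertex p \<noteq> UNIV"
    using vertex_subset_plane plane_neq_UNIV p by blast
  ultimately show ?thesis by (simp add: comaximal_vertices_def subalgebra_vertex)
qed

text \<open>Some element of \<open>A\<close> is not central. Its direction \<open>d\<close> is the
  only one in \<open>A\<close>, since a second would generate everything; so \<open>A\<close> lies
  between a \<open>line\<close> and \<open>plane d\<close>, and equals one of them.\<close>

lemma comaximal_vertices_cases:
  assumes "A \<in> comaximal_vertices" "A \<noteq> center"
  shows "A \<in> range vertex"
proof -
  have A: "subalgebra A" "A \<noteq> {0}" "A \<noteq> UNIV" using assms by (auto simp: comaximal_vertices_def)
  then have sub: "subspace A" by (simp add: subalgebra_def)
  have center: "center \<subseteq> A" if "vec 0 0 c \<in> A" "c \<noteq> 0" for c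
  proof -
    have "vec 0 0 w \<in> A" for w
      using subspace_scale[OF sub that(1), of "w / c"] that(2) by (simp add: vec_scale)
    then show ?thesis by (auto simp: center_def)
  qed
  \<comment> \<open>Otherwise \<open>A\<close> is a nonzero subspace of the one-dimensional centre,
    hence the centre itself.\<close>
  have "\<exists>a b c. vec a b c \<in> A \<and> (a \<noteq> 0 \<or> b \<noteq> 0)"
  proof (rule ccontr)
    assume *: "\<not> ?thesis"
    then have "A \<subseteq> center"
      unfolding center_def by (metis rangeI subsetI vec_exhaust)
    moreover obtain x where "x \<in> A" "x \<noteq> 0"
      using A(2) subspace_0[OF sub] by blast
    moreover from calculation obtain c where "x = vec 0 0 c" by (auto simp: center_def)
    ultimately have "center \<subseteq> A" using center vec_zero by metis
    with \<open>A \<subseteq> center\<close> assms(2) show False by blast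
  qed
  then obtain a b c where abc: "vec a b c \<in> A" "a \<noteq> 0 \<or> b \<noteq> 0" by blast
  obtain d k where dk: "a = k * dir_fst d" "b = k * dir_snd d" by (rule dir_exhaust)
  \<comment> \<open>Dividing by \<open>k\<close> normalizes the image to the direction vector, and
    \<open>s\<close> is the resulting height.\<close>
  define s where "s = c / k"
  have "k \<noteq> 0" using abc dk by auto
  then have "vec (dir_fst d) (dir_snd d) s = scale (inverse k) (vec a b c)"
    by (simp add: vec_scale dk s_def field_simps)
  then have dir: "vec (dir_fst d) (dir_snd d) s \<in> A"
    using sub abc by (simp add: subspace_scale)
  have line: "vec (r * dir_fst d) (r * dir_snd d) (r * s) \<in> A" for r
    using subspace_scale[OF sub dir, of r] by (simp add: vec_scale)
  have subset: "A \<subseteq> plane d"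
  proof
    fix x assume "x \<in> A"
    obtain u v w where x: "x = vec u v w" by (rule vec_exhaust)
    have "dir_fst d * v - dir_snd d * u = 0"
      using subalgebra_eq_UNIV[OF A(1) dir] \<open>x \<in> A\<close> A(3) x by blast
    then obtain r where "u = r * dir_fst d" "v = r * dir_snd d" by (rule dir_proportional)
    then show "x \<in> plane d" unfolding plane_def x by blast
  qed
  show ?thesis
  proof (cases "A \<subseteq> line d s")
    case True
    then have "A = vertex (d, Some s)" using line by (auto simp: vertex_def line_def)
    then show ?thesis by blast
  next
    case False
    then obtain x where "x \<in> A" "x \<notin> line d s" by blast
    then obtain r w where x: "x = vec (r * dir_fst d) (r * dir_snd d) w"
      using subset by (auto simp: plane_def)
    have "w \<noteq> r * s" using \<open>x \<notin> line d s\<close> by (auto simp: line_def x)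
    \<comment> \<open>Subtracting the point of the line with the same image leaves a nonzero central
      element.\<close>
    have "vec 0 0 (w - r * s) = x + scale (- 1) (vec (r * dir_fst d) (r * dir_snd d) (r * s))"
      by (simp add: x vec_scale vec_add)
    also have "\<dots> \<in> A" by (intro subspace_add subspace_scale sub \<open>x \<in> A\<close> line)
    finally have cA: "center \<subseteq> A" using center \<open>w \<noteq> r * s\<close> by simp
    have "vec (r * dir_fst d) (r * dir_snd d) w \<in> A" for r w
    proof -
      have "vec (r * dir_fst d) (r * dir_snd d) w =
          vec (r * dir_fst d) (r * dir_snd d) (r * s) + vec 0 0 (w - r * s)"
        by (simp add: vec_add)
      also have "\<dots> \<in> A"
        using cA by (intro subspace_add sub line) (auto simp: center_def)
      finally show ?thesis .
    qed
    then have "A = vertex (d, None)" using subset by (auto simp: vertex_def plane_def)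
    then show ?thesis by blast
  qed
qed

section \<open>Adjacency and triangles\<close>

lemma generated_subset:
  assumes "subalgebra S" "X \<subseteq> S"
  shows "generated_subalgebra X \<subseteq> S"
  using assms by (simp add: generated_subalgebra_def hull_minimal)

lemma subalgebra_generated: "subalgebra (generated_subalgebra X)"
  unfolding generated_subalgebra_def
  by (rule hull_in) (auto simp: subalgebra_def intro: subspace_Inter)

text \<open>Equal directions keep both vertices in one proper plane; different directions have
  nonzero determinant.\<close>

lemma generated_vertices_eq_UNIV_iff:
  "generated_subalgebra (vertex p \<union> vertex p') = UNIV \<longleftrightarrow> fst p \<noteq> fst p'"
proof -
  obtain d m d' m' where p: "p = (d, m)" "p' = (d', m')" by (metis surj_pair)
  show ?thesis
  proof (cases "d = d'")
    case True
    then have "generated_subalgebra (vertex p \<union> vertex p') \<subseteq> plane d"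
      using p by (intro generated_subset subalgebra_plane) (auto dest: subsetD[OF vertex_subset_plane])
    then show ?thesis using True p plane_neq_UNIV by auto
  next
    case False
    obtain c c' where
      "vec (dir_fst d) (dir_snd d) c \<in> vertex p" "vec (dir_fst d') (dir_snd d') c' \<in> vertex p'"
      using vertex_contains_dir p by metis
    moreover have "vertex p \<union> vertex p' \<subseteq> generated_subalgebra (vertex p \<union> vertex p')"
      by (simp add: generated_subalgebra_def hull_subset)
    ultimately have "generated_subalgebra (vertex p \<union> vertex p') = UNIV"
      using False dir_det_eq_0_iff[of d d'] by (intro subalgebra_eq_UNIV[OF subalgebra_generated]) auto
    then show ?thesis using False p by simp
  qed
qed

lemma generated_center_vertex_neq_UNIV: "generated_subalgebra (center \<union> vertex p) \<noteq> UNIV"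
proof -
  have "generated_subalgebra (center \<union> vertex p) \<subseteq> plane (fst p)"
    using center_subset_plane vertex_subset_plane[of "fst p" "snd p"]
    by (intro generated_subset subalgebra_plane) auto
  then show ?thesis using plane_neq_UNIV by auto
qed

lemma inj_vertex: "inj vertex"
proof (rule injI)
  fix p p' assume eq: "vertex p = vertex p'"
  have "fst p = fst p'"
    \<comment> \<open>As the vertices coincide, the criterion for \<open>p, p'\<close> must agree
      with the one for \<open>p, p\<close>, where generation fails.\<close>
    using generated_vertices_eq_UNIV_iff[of p p'] generated_vertices_eq_UNIV_iff[of p p] eq by auto
  then obtain d m m' where p: "p = (d, m)" "p' = (d, m')" by (metis prod.collapse)
  have neq: "plane d \<noteq> line d s" for s
  proof
    assume "plane d = line d s"
    then have "vec 0 0 1 \<in> line d s"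
      using center_subset_plane[of d] by (auto simp: center_def)
    then show False using dir_nonzero[of d] by (auto simp: line_def vec_eq_iff)
  qed
  have "s = s'" if "line d s = line d s'" for s s'
  proof -
    have "vec (dir_fst d) (dir_snd d) s \<in> line d s"
      by (auto simp: line_def intro: exI[of _ 1])
    then show ?thesis unfolding that using dir_nonzero[of d] by (auto simp: line_def vec_eq_iff)
  qed
  then have "m = m'"
    using eq neq neq[symmetric] by (auto simp: p vertex_def split: option.splits)
  then show "p = p'" by (simp add: p)
qed

text \<open>The centre is isolated, so triangles consist of parametrized vertices, and pairwise
  adjacency means pairwise distinct first components.\<close>

lemma triangles_comaximal_graph:
  "triangles comaximal_graph = image vertex ` {T. card T = 3 \<and> inj_on fst T}"
proof (intro equalityI subsetI)
  note edge = doubleton_mem_comaximal_edges[OF lie_algebra_axioms]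
  {
    fix T assume "T \<in> triangles comaximal_graph"
    then have T: "T \<subseteq> comaximal_vertices" "card T = 3"
      "\<And>A B. A \<in> T \<Longrightarrow> B \<in> T \<Longrightarrow> A \<noteq> B \<Longrightarrow> generated_subalgebra (A \<union> B) = UNIV"
      by (auto simp: triangles_def edge) (auto simp: comaximal_graph_def)
    have "center \<notin> T"
    proof
      assume "center \<in> T"
      moreover have "\<not> T \<subseteq> {center}"
        using T(2) card_mono[of "{center}" T] by auto
      ultimately obtain B where "B \<in> T" "B \<noteq> center" by blast
      moreover from this obtain p where "B = vertex p"
        using T(1) comaximal_vertices_cases by blast
      ultimately show False
        using T(3)[OF \<open>center \<in> T\<close>] generated_center_vertex_neq_UNIV by blast
    qed
    then have "T \<subseteq> range vertex" using T(1) comaximal_vertices_cases by blast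
    then obtain U where U: "T = vertex ` U" by (auto simp: subset_image_iff)
    have "card U = 3"
      using T(2) inj_vertex by (simp add: U card_image inj_on_subset)
    moreover have "inj_on fst U"
    proof (rule inj_onI, rule ccontr)
      fix p p' assume "p \<in> U" "p' \<in> U" "fst p = fst p'" "p \<noteq> p'"
      then show False
        using T(3)[of "vertex p" "vertex p'"] inj_vertex
        by (auto simp: U generated_vertices_eq_UNIV_iff inj_eq)
    qed
    ultimately show "T \<in> image vertex ` {T. card T = 3 \<and> inj_on fst T}" using U by blast
  next
    fix T assume "T \<in> image vertex ` {T. card T = 3 \<and> inj_on fst T}"
    then obtain U where U: "T = vertex ` U" "card U = 3" "inj_on fst U" by blast
    have "card T = 3"
      using U inj_vertex by (simp add: card_image inj_on_subset)
    moreover have "T \<subseteq> fst comaximal_graph"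
      using vertex_in_comaximal_vertices by (auto simp: comaximal_graph_def U)
    moreover have "{A, B} \<in> snd comaximal_graph" if "A \<in> T" "B \<in> T" "A \<noteq> B" for A B
    proof -
      obtain p p' where p: "p \<in> U" "p' \<in> U" "A = vertex p" "B = vertex p'"
        using \<open>A \<in> T\<close> \<open>B \<in> T\<close> U(1) by blast
      with \<open>A \<noteq> B\<close> have "fst p \<noteq> fst p'" using inj_onD[OF U(3)] by blast
      then show ?thesis
        using \<open>A \<noteq> B\<close>
        by (simp add: p(3,4) edge vertex_in_comaximal_vertices generated_vertices_eq_UNIV_iff)
    qed
    ultimately show "T \<in> triangles comaximal_graph" by (auto simp: triangles_def)
  }
qed

end

section \<open>Evaluation of the count\<close>

lemma choose_3_real: "real (Suc n choose 3) = real n * (real n - 1) * (real n + 1) / 6"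
proof (induction n)
  case (Suc n)
  \<comment> \<open>The summand that Pascal's rule adds in the induction step.\<close>
  have "real (Suc n choose 2) = (real n + 1) * real n / 2"
    by (induction n) (simp_all add: numeral_2_eq_2 field_simps)
  then show ?case
    using Suc by (simp add: numeral_3_eq_3 numeral_2_eq_2 field_simps)
qed (simp add: numeral_3_eq_3)

theorem proposition3p3:
  fixes scale :: "'a::{field,finite} \<Rightarrow> 'b::ab_group_add \<Rightarrow> 'b"
    and bracket :: "'b \<Rightarrow> 'b \<Rightarrow> 'b"
    and e f h :: 'b
    and q :: nat
  assumes "q = CARD('a)"
    and "heisenberg_lie_algebra scale bracket e f h"
  shows "real (num_triangles (lie_algebra.comaximal_graph scale bracket)) =
           real q * (real q - 1) * (real q + 1) ^ 4 / 6"
proof -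
  interpret heisenberg_lie_algebra scale bracket e f h by fact
  have "inj (image vertex)"
    by (intro injI) (simp add: inj_image_eq_iff inj_vertex)
  then have "num_triangles comaximal_graph =
      card {T :: ('a option \<times> 'a option) set. card T = 3 \<and> inj_on fst T}"
    by (simp add: num_triangles_def triangles_comaximal_graph card_image inj_on_subset)
  \<comment> \<open>There are \<open>q + 1\<close> directions and \<open>q + 1\<close> members in
    each part, both indexed by \<open>'a option\<close>.\<close>
  also have "\<dots> = (Suc q choose 3) * Suc q ^ 3"
    using card_subsets_inj_on_fst[of "UNIV :: 'a option set" "UNIV :: 'a option set" 3]
    by (simp add: assms(1) card_UNIV_option)
  finally have "real (num_triangles comaximal_graph) = real (Suc q choose 3) * (real q + 1) ^ 3"
    by (simp add: add.commute)
  then show ?thesis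
    by (simp add: choose_3_real power4_eq_xxxx power3_eq_cube)
qed

end
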